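(* Let $X$ be a finite set of alternatives with $|X|=m\geq 2$ and $N=\{1,\dots,n\}$ with $n\geq 2$ a set of individuals. Let $G$ be a social choice correspondence on $L(X)^N$ that is non-constant (i.e. there exist profiles $u,u^*$ with $G(u)\neq G(u^* )$) and that has an ineffective individual. Then $G$ is unbalanced (i.e. it does not satisfy balancedness).
   Context: An ordering on $X$ is a complete, asymmetric, transitive relation on $X$ (a strict linear order); $L(X)$ is the set of all orderings. A profile is an element $u=(u(1),\dots,u(n))\in L(X)^N$. A social choice correspondence is a map $G$ from $L(X)^N$ to the non-empty subsets of $X$. Profile $v$ is constructed from profile $u$ by transposition pair $(x,y)$ via individuals $i$ and $j$ if at $u$, $x$ is immediately above $y$ in $u(i)$ and $y$ is immediately above $x$ in $u(j)$, and $v$ is identical to $u$ except that in the orderings of $i$ and $j$ the alternatives $x$ and $y$ are swapped. $G$ is balanced (satisfies balancedness) if for all $x,y,u,v,i,j$, whenever $v$ is constructed from $u$ by transposition pair $(x,y)$ via individuals $i$ and $j$, then $G(v)=G(u)$; otherwise $G$ is unbalanced. An individual $i$ is ineffective for $G$ if for all profiles $u,u^*$ with $u(j)=u^*(j)$ for all $j\neq i$, we have $G(u)=G(u^* )$. *)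

theory Defs
  imports Main "HOL-Library.FuncSet" "HOL-Combinatorics.Transposition"
begin

text \<open>An ordering is encoded by the set of pairs \<open>(x, y)\<close> such that \<open>x\<close> is ranked above \<open>y\<close>.\<close>

definition orderings :: "'a set \<Rightarrow> ('a \<times> 'a) set set" where
  "orderings X = {r. r \<subseteq> X \<times> X \<and> total_on X r \<and> asym r \<and> trans r}"

text \<open>Profiles are extensional functions (equal to \<open>undefined\<close> outside \<open>{1..n}\<close>), so that
  equality of profiles is agreement on the individuals.\<close>

definition profiles :: "'a set \<Rightarrow> nat \<Rightarrow> (nat \<Rightarrow> ('a \<times> 'a) set) set" where
  "profiles X n = {1..n} \<rightarrow>\<^sub>E orderings X"

definition social_choice_correspondence ::
    "'a set \<Rightarrow> nat \<Rightarrow> ((nat \<Rightarrow> ('a \<times> 'a) set) \<Rightarrow> 'a set) \<Rightarrow> bool" where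
  "social_choice_correspondence X n G \<longleftrightarrow> G \<in> profiles X n \<rightarrow> Pow X - {{}}"

definition immediately_above :: "('a \<times> 'a) set \<Rightarrow> 'a \<Rightarrow> 'a \<Rightarrow> bool" where
  "immediately_above r x y \<longleftrightarrow> (x, y) \<in> r \<and> \<not> (\<exists>z. (x, z) \<in> r \<and> (z, y) \<in> r)"

definition swap_alternatives :: "'a \<Rightarrow> 'a \<Rightarrow> ('a \<times> 'a) set \<Rightarrow> ('a \<times> 'a) set" where
  "swap_alternatives x y r = map_prod (transpose x y) (transpose x y) ` r"

text \<open>The two conditions on \<open>u i\<close> and \<open>u j\<close> force \<open>i \<noteq> j\<close> and \<open>x \<noteq> y\<close> by asymmetry.\<close>

definition constructed_by_transposition_pair ::
    "nat \<Rightarrow> (nat \<Rightarrow> ('a \<times> 'a) set) \<Rightarrow> (nat \<Rightarrow> ('a \<times> 'a) set) \<Rightarrow>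
     'a \<Rightarrow> 'a \<Rightarrow> nat \<Rightarrow> nat \<Rightarrow> bool" where
  "constructed_by_transposition_pair n v u x y i j \<longleftrightarrow>
     i \<in> {1..n} \<and> j \<in> {1..n} \<and>
     immediately_above (u i) x y \<and> immediately_above (u j) y x \<and>
     v = u(i := swap_alternatives x y (u i), j := swap_alternatives x y (u j))"

definition balanced ::
    "'a set \<Rightarrow> nat \<Rightarrow> ((nat \<Rightarrow> ('a \<times> 'a) set) \<Rightarrow> 'a set) \<Rightarrow> bool" where
  "balanced X n G \<longleftrightarrow>
     (\<forall>x\<in>X. \<forall>y\<in>X. \<forall>u\<in>profiles X n. \<forall>v\<in>profiles X n. \<forall>i\<in>{1..n}. \<forall>j\<in>{1..n}.
        constructed_by_transposition_pair n v u x y i j \<longrightarrow> G v = G u)"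

definition ineffective ::
    "'a set \<Rightarrow> nat \<Rightarrow> ((nat \<Rightarrow> ('a \<times> 'a) set) \<Rightarrow> 'a set) \<Rightarrow> nat \<Rightarrow> bool" where
  "ineffective X n G i \<longleftrightarrow>
     (\<forall>u\<in>profiles X n. \<forall>u'\<in>profiles X n.
        (\<forall>j\<in>{1..n} - {i}. u j = u' j) \<longrightarrow> G u = G u')"

end

theory Submission imports Defs begin

text \<open>
  Under balancedness, an ineffective individual \<open>i\<close> can absorb any adjacent swap: if \<open>x\<close> is
  immediately above \<open>y\<close> in \<open>u j\<close>, first give \<open>i\<close> the swapped version of \<open>u j\<close>; then
  swapping \<open>x\<close> and \<open>y\<close> for both \<open>i\<close> and \<open>j\<close> does not change the choice, and neither did
  the modifications of \<open>u i\<close>. Hence the choice is invariant under adjacent swaps in the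
  ordering of any individual. Since adjacent swaps connect all orderings of a finite set,
  the choice is constant.
\<close>

text \<open>A transposition is its own inverse, so membership in the image is tested by transposing
  the pair itself. In this form, order properties of the swapped relation reduce to those of
  \<open>r\<close>.\<close>

lemma in_swap_alternatives_iff:
  "(a, b) \<in> swap_alternatives x y r \<longleftrightarrow> (transpose x y a, transpose x y b) \<in> r"
proof
  assume "(a, b) \<in> swap_alternatives x y r"
  then show "(transpose x y a, transpose x y b) \<in> r"
    by (auto simp: swap_alternatives_def)
next
  assume "(transpose x y a, transpose x y b) \<in> r"
  then have "map_prod (transpose x y) (transpose x y) (transpose x y a, transpose x y b)
      \<in> swap_alternatives x y r"
    unfolding swap_alternatives_def by (rule imageI)
  then show "(a, b) \<in> swap_alternatives x y r" by simp
qed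

lemma swap_alternatives_in_orderings:
  assumes r: "r \<in> orderings X" and "x \<in> X" and "y \<in> X"
  shows "swap_alternatives x y r \<in> orderings X"
proof -
  have sub: "r \<subseteq> X \<times> X" and tot: "total_on X r" and asym: "asym r" and trans: "trans r"
    using r by (auto simp: orderings_def)
  have mem: "transpose x y a \<in> X \<longleftrightarrow> a \<in> X" for a
    using assms by (auto simp: transpose_def)
  have "swap_alternatives x y r \<subseteq> X \<times> X"
    using sub mem by (auto simp: in_swap_alternatives_iff)
  moreover have "total_on X (swap_alternatives x y r)"
    using tot mem unfolding total_on_def in_swap_alternatives_iff
    by (metis transpose_eq_imp_eq)
  moreover have "asym (swap_alternatives x y r)"
    using asym by (auto simp: asym_on_def in_swap_alternatives_iff)
  moreover have "trans (swap_alternatives x y r)"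
    using trans unfolding trans_def in_swap_alternatives_iff by blast
  ultimately show ?thesis by (simp add: orderings_def)
qed

lemma immediately_above_swap_alternatives:
  assumes "immediately_above r x y"
  shows "immediately_above (swap_alternatives x y r) y x"
  using assms unfolding immediately_above_def in_swap_alternatives_iff
  by (metis transpose_apply_first transpose_apply_second)

text \<open>Nothing lies between \<open>x\<close> and \<open>y\<close>, so totality and transitivity
  place every other alternative above both or below both. Transposing therefore affects only the
  pair \<open>(x, y)\<close>.\<close>

lemma swap_alternatives_immediately_above:
  assumes r: "r \<in> orderings X" and imm: "immediately_above r x y"
  shows "swap_alternatives x y r = insert (y, x) (r - {(x, y)})"
proof -
  have sub: "r \<subseteq> X \<times> X" and tot: "total_on X r" and asym: "asym r" and trans: "trans r"
    using r by (auto simp: orderings_def)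
  have xy: "(x, y) \<in> r" and between: "\<And>z. (x, z) \<in> r \<Longrightarrow> (z, y) \<notin> r"
    using imm by (auto simp: immediately_above_def)
  have irr: "(a, a) \<notin> r" for a using asym by (auto simp: asym_on_def)
  have yx: "(y, x) \<notin> r" using asym xy by (auto simp: asym_on_def)
  have neq: "x \<noteq> y" using xy irr by auto
  have above: "(z, x) \<in> r \<longleftrightarrow> (z, y) \<in> r" if "z \<noteq> x" "z \<noteq> y" for z
  proof
    show "(z, x) \<in> r \<Longrightarrow> (z, y) \<in> r" using trans xy unfolding trans_def by blast
    assume "(z, y) \<in> r"
    then show "(z, x) \<in> r" using tot between that sub xy unfolding total_on_def by blast
  qed
  have below: "(x, z) \<in> r \<longleftrightarrow> (y, z) \<in> r" if "z \<noteq> x" "z \<noteq> y" for z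
  proof
    show "(y, z) \<in> r \<Longrightarrow> (x, z) \<in> r" using trans xy unfolding trans_def by blast
    assume "(x, z) \<in> r"
    then show "(y, z) \<in> r" using tot between that sub xy unfolding total_on_def by blast
  qed
  have "(a, b) \<in> swap_alternatives x y r \<longleftrightarrow> (a, b) \<in> insert (y, x) (r - {(x, y)})" for a b
    by (cases "a = x"; cases "a = y"; cases "b = x"; cases "b = y")
      (simp_all add: in_swap_alternatives_iff transpose_def xy yx neq neq[symmetric] irr above below)
  then show ?thesis by auto
qed

text \<open>Induction on the number of alternatives strictly between \<open>x\<close> and
  \<open>y\<close>: any such \<open>z\<close> splits the pair into two with fewer in between, and
  transitivity of \<open>s\<close> joins them again.\<close>

lemma ordering_subset_if_immediately_above_subset:
  assumes "finite X" and r: "r \<in> orderings X" and s: "s \<in> orderings X"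
    and imm: "\<And>x y. immediately_above r x y \<Longrightarrow> (x, y) \<in> s"
  shows "r \<subseteq> s"
proof -
  have sub: "r \<subseteq> X \<times> X" and asym: "asym r" and trans: "trans r" and "trans s"
    using r s by (auto simp: orderings_def)
  have fin: "finite {z. (x, z) \<in> r \<and> (z, y) \<in> r}" for x y
    using sub by (intro finite_subset[OF _ \<open>finite X\<close>]) auto
  have "(x, y) \<in> s" if "(x, y) \<in> r" for x y
    using that
  proof (induction "card {z. (x, z) \<in> r \<and> (z, y) \<in> r}" arbitrary: x y rule: less_induct)
    case less
    show ?case
    proof (cases "immediately_above r x y")
      case True
      then show ?thesis by (rule imm)
    next
      case False
      then obtain z where z: "(x, z) \<in> r" "(z, y) \<in> r"
        using less.prems by (auto simp: immediately_above_def)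
      have irr: "(z, z) \<notin> r" using asym by (auto simp: asym_on_def)
      \<comment> \<open>The inclusion is strict because \<open>z\<close> lies in the larger set
        only.\<close>
      have "{w. (x, w) \<in> r \<and> (w, z) \<in> r} \<subset> {w. (x, w) \<in> r \<and> (w, y) \<in> r}"
        using z irr transD[OF trans] by blast
      then have "(x, z) \<in> s" by (intro less.hyps psubset_card_mono fin z)
      have "{w. (z, w) \<in> r \<and> (w, y) \<in> r} \<subset> {w. (x, w) \<in> r \<and> (w, y) \<in> r}"
        using z irr transD[OF trans] by blast
      then have "(z, y) \<in> s" by (intro less.hyps psubset_card_mono fin z)
      with \<open>(x, z) \<in> s\<close> show ?thesis by (rule transD[OF \<open>trans s\<close>])
    qed
  qed
  then show ?thesis by auto
qed

text \<open>By totality, a pair of \<open>s\<close> missing from \<open>r\<close> would occur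
  reversed in \<open>r\<close>, hence in \<open>s\<close>, against asymmetry.\<close>

lemma orderings_subset_imp_eq:
  assumes "r \<in> orderings X" and "s \<in> orderings X" and "r \<subseteq> s"
  shows "r = s"
proof -
  have "(x, y) \<in> r" if xy: "(x, y) \<in> s" for x y
  proof -
    have "asym s" "x \<in> X" "y \<in> X" using assms(2) xy by (auto simp: orderings_def)
    then have "(y, x) \<notin> s" "x \<noteq> y" using xy by (auto simp: asym_on_def)
    then show ?thesis
      using assms \<open>x \<in> X\<close> \<open>y \<in> X\<close> unfolding orderings_def total_on_def by blast
  qed
  then show ?thesis using assms(3) by auto
qed

text \<open>Bubble sort: swapping an adjacent pair on which \<open>r\<close> and \<open>s\<close> disagree shrinks \<open>r - s\<close>.\<close>

lemma adjacent_swap_invariant_imp_constant: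
  assumes "finite X" and "r \<in> orderings X" and s: "s \<in> orderings X"
    and inv: "\<And>r x y. r \<in> orderings X \<Longrightarrow> immediately_above r x y \<Longrightarrow>
      f (swap_alternatives x y r) = f r"
  shows "f r = f s"
  using \<open>r \<in> orderings X\<close>
proof (induction "card (r - s)" arbitrary: r rule: less_induct)
  case less
  show ?case
  proof (cases "r = s")
    case False
    \<comment> \<open>If \<open>s\<close> contained all adjacent pairs of \<open>r\<close>, it would
      contain \<open>r\<close> and so equal it.\<close>
    then obtain x y where imm: "immediately_above r x y" and nxy: "(x, y) \<notin> s"
      using ordering_subset_if_immediately_above_subset[OF \<open>finite X\<close> less.prems s]
        orderings_subset_imp_eq[OF less.prems s] by blast
    have sub: "r \<subseteq> X \<times> X" using less.prems by (simp add: orderings_def)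
    have xy: "(x, y) \<in> r" using imm by (simp add: immediately_above_def)
    then have "x \<in> X" "y \<in> X" "x \<noteq> y"
      using sub less.prems by (auto simp: orderings_def asym_on_def)
    then have "(y, x) \<in> s" using s nxy by (auto simp: orderings_def total_on_def)
    \<comment> \<open>The swap removes \<open>(x, y)\<close> from the difference, and the new pair
      \<open>(y, x)\<close> lies in \<open>s\<close>.\<close>
    then have "swap_alternatives x y r - s \<subset> r - s"
      using swap_alternatives_immediately_above[OF less.prems imm] xy nxy by auto
    moreover have "finite (r - s)"
      using sub \<open>finite X\<close> by (blast intro: finite_subset)
    ultimately have "f (swap_alternatives x y r) = f s"
      by (intro less.hyps psubset_card_mono swap_alternatives_in_orderings
          less.prems \<open>x \<in> X\<close> \<open>y \<in> X\<close>)
    then show ?thesis using inv[OF less.prems imm] by simp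
  qed simp
qed

lemma profiles_fun_upd:
  assumes "u \<in> profiles X n" and "j \<in> {1..n}" and "s \<in> orderings X"
  shows "u(j := s) \<in> profiles X n"
  using assms by (auto simp: profiles_def PiE_iff extensional_def)

lemma ineffective_fun_upd:
  assumes "ineffective X n G i" and "i \<in> {1..n}" and "u \<in> profiles X n" and "s \<in> orderings X"
  shows "G (u(i := s)) = G u"
proof -
  have "\<forall>j\<in>{1..n} - {i}. (u(i := s)) j = u j" by simp
  then show ?thesis
    using assms profiles_fun_upd unfolding ineffective_def by blast
qed

lemma balanced_ineffective_adjacent_swap:
  assumes "balanced X n G" and "ineffective X n G i" and i: "i \<in> {1..n}"
    and u: "u \<in> profiles X n" and j: "j \<in> {1..n}" and "j \<noteq> i"
    and imm: "immediately_above (u j) x y"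
  shows "G (u(j := swap_alternatives x y (u j))) = G u"
proof -
  have uj: "u j \<in> orderings X" using u j by (auto simp: profiles_def)
  have xy: "x \<in> X" "y \<in> X" using uj imm by (auto simp: orderings_def immediately_above_def)
  define s where "s = swap_alternatives x y (u j)"
  define t where "t = swap_alternatives x y s"
  have s: "s \<in> orderings X" and t: "t \<in> orderings X"
    unfolding s_def t_def by (intro swap_alternatives_in_orderings uj xy)+
  \<comment> \<open>In \<open>w\<close>, individual \<open>i\<close> ranks \<open>y\<close>
    immediately above \<open>x\<close>, opposite to \<open>j\<close>, as balancedness demands;
    \<open>v\<close> is the outcome of the joint swap.\<close>
  define w where "w = u(i := s)"
  define v where "v = u(j := s, i := t)"
  have w: "w \<in> profiles X n" and us: "u(j := s) \<in> profiles X n" and v: "v \<in> profiles X n"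
    unfolding w_def v_def by (intro profiles_fun_upd u i j s t)+
  have "v = w(j := swap_alternatives x y (w j), i := swap_alternatives x y (w i))"
    using \<open>j \<noteq> i\<close> by (auto simp: v_def w_def s_def t_def)
  moreover have "immediately_above (w i) y x"
    using immediately_above_swap_alternatives[OF imm] by (simp add: w_def s_def)
  ultimately have "constructed_by_transposition_pair n v w x y j i"
    using i j imm \<open>j \<noteq> i\<close> by (simp add: constructed_by_transposition_pair_def w_def)
  then have "G v = G w"
    using \<open>balanced X n G\<close> xy v w i j unfolding balanced_def by blast
  moreover have "G w = G u"
    unfolding w_def by (rule ineffective_fun_upd[OF assms(2) i u s])
  moreover have "G v = G (u(j := s))"
    unfolding v_def by (rule ineffective_fun_upd[OF assms(2) i us t])
  ultimately show ?thesis by (simp add: s_def)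
qed

text \<open>For \<open>j = i\<close> this is ineffectiveness; any other \<open>j\<close> reaches
  \<open>s\<close> from \<open>u j\<close> by adjacent swaps, each of which preserves the
  choice.\<close>

lemma balanced_ineffective_fun_upd:
  assumes "finite X" and "balanced X n G" and "ineffective X n G i" and "i \<in> {1..n}"
    and u: "u \<in> profiles X n" and j: "j \<in> {1..n}" and s: "s \<in> orderings X"
  shows "G (u(j := s)) = G u"
proof (cases "j = i")
  case True
  then show ?thesis using ineffective_fun_upd assms by blast
next
  case False
  have "u j \<in> orderings X" using u j by (auto simp: profiles_def)
  \<comment> \<open>The trivial update presents both sides as values of one function of the ordering
    of \<open>j\<close>.\<close>
  then have "G (u(j := u j)) = G (u(j := s))"
  proof (rule adjacent_swap_invariant_imp_constant[where f = "\<lambda>r. G (u(j := r))",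
        OF \<open>finite X\<close> _ s])
    fix r x y assume "r \<in> orderings X" and "immediately_above r x y"
    then show "G (u(j := swap_alternatives x y r)) = G (u(j := r))"
      using balanced_ineffective_adjacent_swap[OF assms(2-4) profiles_fun_upd[OF u j] j False]
      by simp
  qed
  then show ?thesis by simp
qed

text \<open>Individuals pass from \<open>u\<close> to \<open>u'\<close> one at a time;
  \<open>S\<close> collects those already changed.\<close>

lemma balanced_ineffective_constant:
  assumes "finite X" and "balanced X n G" and "ineffective X n G i" and "i \<in> {1..n}"
    and u: "u \<in> profiles X n" and u': "u' \<in> profiles X n"
  shows "G u = G u'"
proof -
  have "override_on u u' S \<in> profiles X n \<and> G (override_on u u' S) = G u"
    if "finite S" "S \<subseteq> {1..n}" for S
    using that
  proof (induction S rule: finite_induct)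
    case empty
    then show ?case using u by simp
  next
    case (insert j S)
    have S: "override_on u u' S \<in> profiles X n" "G (override_on u u' S) = G u"
      using insert by auto
    have j: "j \<in> {1..n}" using insert.prems by simp
    then have j': "u' j \<in> orderings X" using u' by (auto simp: profiles_def)
    show ?case
      unfolding override_on_insert
      using profiles_fun_upd[OF S(1) j j'] balanced_ineffective_fun_upd[OF assms(1-4) S(1) j j'] S(2)
      by (simp only: simp_thms)
  qed
  then have "G (override_on u u' {1..n}) = G u" by blast
  \<comment> \<open>Outside \<open>{1..n}\<close> both profiles are \<open>undefined\<close>, so
    they agree there.\<close>
  moreover have "override_on u u' {1..n} = u'"
    using u u' by (intro ext) (auto simp: override_on_def profiles_def PiE_iff extensional_def)
  ultimately show ?thesis by simp
qed

theorem theorem1: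
  fixes X :: "'a set" and n :: nat
    and G :: "(nat \<Rightarrow> ('a \<times> 'a) set) \<Rightarrow> 'a set"
  assumes "finite X" and "card X \<ge> 2" and "n \<ge> 2"
    and "social_choice_correspondence X n G"
    and "\<exists>u\<in>profiles X n. \<exists>u'\<in>profiles X n. G u \<noteq> G u'"
    and "\<exists>i\<in>{1..n}. ineffective X n G i"
  shows "\<not> balanced X n G"
  using assms(1,5,6) balanced_ineffective_constant by metis

end
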